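(* Let $c\in\mathbb{N}$ be fixed, let $\tilde Y^{(c)}\sim\mathrm{Gamma}(c,1)$, and let $\tilde Y_{n:n}^{(c)}$ be the maximum of $n$ i.i.d. copies of $\tilde Y^{(c)}$. For $s\ge0$ and an integer $r\ge1$ consider the upper bound $$U_n(s)=s+n\int_s^\infty\mathbb{P}\bigl((\tilde Y^{(c)})^r>t\bigr)\,dt\ \ge\ \mathbb{E}\bigl[(\tilde Y_{n:n}^{(c)})^r\bigr].$$ For every integer $r\ge1$ there is a sequence $(s_n)$ for which this bound is asymptotically tight in $n$, i.e. $\lim_{n\to\infty}U_n(s_n)/\mathbb{E}[(\tilde Y_{n:n}^{(c)})^r]=1$. In particular this holds for $s_n=b_n^r$ (for $n$ large), where $$b_n=\log n-\log\Gamma(c)+(c-1)\log\log n,$$ and this choice is asymptotically optimal in the sense that it asymptotically satisfies the optimality condition $n\,\mathbb{P}((\tilde Y^{(c)})^r>s)=1$ for minimizing $U_n(s)$, that is, $\lim_{n\to\infty}n\,\mathbb{P}\bigl((\tilde Y^{(c)})^r>b_n^r\bigr)=1$.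
   Context: $\mathrm{Gamma}(c,1)$ is the law of the sum of $c$ independent unit-rate exponential random variables. The upper bound is the Ross–Peköz inequality: for nonnegative $Z_1,\ldots,Z_n$, $\mathbb{E}[\max_jZ_j]\le s+\sum_{j=1}^n\int_s^\infty\mathbb{P}(Z_j>z)\,dz$ for all $s\ge0$, which is tightest at $s^*$ with $\sum_j\mathbb{P}(Z_j>s^* )=1$; here $Z_j=(\tilde Y_j^{(c)})^r$. *)

theory Defs
  imports "HOL-Probability.Probability"
begin

text \<open>
  \<open>Gamma(c,1)\<close> is the law of the sum of \<open>c\<close> independent unit-rate exponentials; the
  independence is that of the coordinates of the product measure.
\<close>

definition gamma_law :: "nat \<Rightarrow> real measure" where
  "gamma_law c =
     distr (\<Pi>\<^sub>M i\<in>{..<c}. density lborel (\<lambda>x. ennreal (exponential_density 1 x))) borel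
       (\<lambda>x. \<Sum>i<c. x i)"

definition sample_max :: "nat \<Rightarrow> (nat \<Rightarrow> 'b \<Rightarrow> real) \<Rightarrow> 'b \<Rightarrow> real" where
  "sample_max n X \<omega> = Max ((\<lambda>j. X j \<omega>) ` {..<n})"

text \<open>The Ross-Pekoz bound for the maximum of \<open>n\<close> identically distributed copies of \<open>Z\<close>.\<close>

definition max_bound :: "'a measure \<Rightarrow> ('a \<Rightarrow> real) \<Rightarrow> nat \<Rightarrow> real \<Rightarrow> real" where
  "max_bound M Z n s = s + real n * (LBINT t:{s..}. \<P>(\<omega> in M. t < Z \<omega>))"

text \<open>Only meaningful for \<open>n \<ge> 2\<close>, since \<open>ln (ln n)\<close> is a junk value for \<open>n \<le> 1\<close>.\<close>

definition gamma_centering :: "nat \<Rightarrow> nat \<Rightarrow> real" where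
  "gamma_centering c n = ln (real n) - ln (Gamma (real c)) + (real c - 1) * ln (ln (real n))"

end

theory Submission
  imports Defs "HOL-Real_Asymp.Real_Asymp"
begin

text \<open>
  With \<open>Z = Y ^ r\<close>, Fubini gives \<open>U\<^sub>n(s) = s + n E[(Z - s)\<^sup>+]\<close>. The Ross-Pekoz inequality is then the
  pointwise bound \<open>max\<^sub>j Z\<^sub>j \<le> s + \<Sum>\<^sub>j (Z\<^sub>j - s)\<^sup>+\<close>, and the optimality condition follows from
  \<open>(Z - s')\<^sup>+ - (Z - s)\<^sup>+ \<ge> (s - s') 1[Z > s]\<close>. Since \<open>x ^ r\<close> times the \<open>Gamma(c,1)\<close> density is a multiple
  of the \<open>Gamma(c + r,1)\<close> density, the excess \<open>E[(Y ^ r - b ^ r)\<^sup>+]\<close> is an explicit combination of two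
  Gamma tails, and \<open>n exp (- b\<^sub>n) b\<^sub>n ^ (c - 1) \<longlonglongrightarrow> (c - 1)!\<close> yields \<open>U\<^sub>n(b\<^sub>n ^ r) / b\<^sub>n ^ r \<longlonglongrightarrow> 1\<close>.
  For the matching lower bound on the expected maximum, put \<open>a\<^sub>n = ln n - ln (ln n)\<close>: then
  \<open>n P(Y > a\<^sub>n) \<ge> ln n\<close>, so the maximum exceeds \<open>a\<^sub>n\<close> with probability at least \<open>1 - 1 / n\<close>.
\<close>

section \<open>The Gamma law: density, tail and truncated moments\<close>

text \<open>The survival function of \<open>Gamma(k,1)\<close> at \<open>a \<ge> 0\<close>,
  equivalently the probability that a Poisson variable of mean \<open>a\<close> is below
  \<open>k\<close>.\<close>

definition gamma_tail :: "nat \<Rightarrow> real \<Rightarrow> real" where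
  "gamma_tail k a = exp (- a) * (\<Sum>j<k. a ^ j / fact j)"

text \<open>The coordinates of the product measure are independent unit exponentials, so the known
  law of their sum applies. \<open>erlang_density\<close> is indexed by the shape minus one, hence
  \<open>c - 1\<close>.\<close>

lemma gamma_law_eq_erlang:
  assumes "1 \<le> c"
  shows "gamma_law c = density lborel (erlang_density (c - 1) 1)"
proof -
  let ?E = "density lborel (\<lambda>x. ennreal (exponential_density 1 x))"
  let ?P = "\<Pi>\<^sub>M i\<in>{..<c}. ?E"
  interpret E: prob_space ?E
    by (rule prob_space_exponential_density) simp
  interpret product_prob_space "\<lambda>_. ?E" "{..<c}" ..
  have component: "distr ?P ?E (\<lambda>x. x i) = ?E" if "i < c" for i
    using PiM_component[of i] that by simp
  have ne: "{..<c} \<noteq> {}"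
    using assms by (auto simp: lessThan_empty_iff)
  have meas: "(\<lambda>x. x i) \<in> borel_measurable ?P" if "i < c" for i
    using measurable_component_singleton[of i "{..<c}" "\<lambda>_. ?E"] that by simp
  have "P.indep_vars (\<lambda>_. ?E) (\<lambda>i x. x i) {..<c}"
  proof (subst P.indep_vars_iff_distr_eq_PiM'[OF ne])
    show "(\<lambda>x. x i) \<in> ?P \<rightarrow>\<^sub>M ?E" if "i \<in> {..<c}" for i
      using that by simp
    \<comment> \<open>Independence is checked as equality of the joint law with the product of the
      marginals. Points of the product space are extensional, so restriction to
      \<open>{..<c}\<close> is the identity there.\<close>
    have "distr ?P ?P (\<lambda>x. \<lambda>i\<in>{..<c}. x i) = distr ?P ?P (\<lambda>x. x)"
      by (intro distr_cong) (auto simp: space_PiM)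
    also have "\<dots> = (\<Pi>\<^sub>M i\<in>{..<c}. distr ?P ?E (\<lambda>x. x i))"
      using component by (simp, intro PiM_cong) auto
    finally show "distr ?P ?P (\<lambda>x. \<lambda>i\<in>{..<c}. x i) = (\<Pi>\<^sub>M i\<in>{..<c}. distr ?P ?E (\<lambda>x. x i))" .
  qed
  then have indep: "P.indep_vars (\<lambda>_. borel) (\<lambda>i x. x i) {..<c}"
    by (rule P.indep_vars_compose2[where Y = "\<lambda>_ x. x", simplified]) simp
  have "distributed ?P lborel (\<lambda>x. x i) (exponential_density 1)" if "i \<in> {..<c}" for i
  proof -
    have "distr ?P lborel (\<lambda>x. x i) = distr ?P ?E (\<lambda>x. x i)"
      by (intro distr_cong) auto
    then show ?thesis
      using that meas component by (auto simp: distributed_def)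
  qed
  from P.exponential_distributed_sum[OF _ ne _ this indep]
  have "distr ?P lborel (\<lambda>x. \<Sum>i<c. x i) = density lborel (erlang_density (c - 1) 1)"
    by (simp add: distributed_def)
  moreover have "distr ?P lborel (\<lambda>x. \<Sum>i<c. x i) = gamma_law c"
    unfolding gamma_law_def by (intro distr_cong) auto
  ultimately show ?thesis by simp
qed

lemma distributed_gamma_law:
  assumes "1 \<le> c" "Y \<in> borel_measurable M" "distr M borel Y = gamma_law c"
  shows "distributed M lborel Y (erlang_density (c - 1) 1)"
proof -
  have "distr M lborel Y = distr M borel Y"
    by (intro distr_cong) auto
  then show ?thesis
    using assms by (simp add: distributed_def gamma_law_eq_erlang)
qed

lemma (in prob_space) erlang_tail:
  assumes D: "distributed M lborel Y (erlang_density k 1)" and a: "0 \<le> a"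
  shows "\<P>(\<omega> in M. a < Y \<omega>) = gamma_tail (Suc k) a"
proof -
  \<comment> \<open>The Erlang distribution function sums over \<open>{..k}\<close>, while
    \<open>gamma_tail\<close> sums strictly below its index; this is the source of
    \<open>Suc k\<close>.\<close>
  have "{..<Suc k} = {..k}" by auto
  then show ?thesis
    using erlang_distributed_gt[OF D _ a] a
    by (simp add: erlang_CDF_def gamma_tail_def sum_distrib_left mult.commute
          del: sum.lessThan_Suc sum.atMost_Suc)
qed

text \<open>The power is absorbed into the polynomial factor of the density, and the quotient of
  factorials restores the normalisation. This turns truncated moments into tail
  probabilities.\<close>

lemma erlang_density_mult_power:
  "erlang_density k 1 x * x ^ r = fact (k + r) / fact k * erlang_density (k + r) 1 x"
  by (simp add: erlang_density_def power_add)

lemma (in prob_space) erlang_AE_nonneg: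
  assumes D: "distributed M lborel Y (erlang_density k 1)"
  shows "AE \<omega> in M. 0 \<le> Y \<omega>"
  by (subst distributed_AE2[OF D]) (auto simp: erlang_density_def)

lemma (in prob_space) erlang_truncated_moment:
  assumes D: "distributed M lborel Y (erlang_density k 1)" and b: "0 \<le> b"
  shows "expectation (\<lambda>\<omega>. Y \<omega> ^ r * indicator {b<..} (Y \<omega>)) =
           fact (k + r) / fact k * gamma_tail (Suc (k + r)) b"
proof -
  let ?D = "density lborel (erlang_density (k + r) 1)"
  interpret D: prob_space ?D
    by (rule prob_space_erlang_density) simp
  \<comment> \<open>The identity on \<open>?D\<close> serves as a random variable with the shifted
    density, so that the tail formula can be reused.\<close>
  have idD: "distributed ?D lborel (\<lambda>x. x) (erlang_density (k + r) 1)"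
    by (auto simp: distributed_def intro!: distr_id2)
  have "expectation (\<lambda>\<omega>. Y \<omega> ^ r * indicator {b<..} (Y \<omega>)) =
      (LBINT x. erlang_density k 1 x * (x ^ r * indicator {b<..} x))"
    by (rule distributed_integral[OF D, symmetric]) auto
  also have "\<dots> = (LBINT x. fact (k + r) / fact k * (erlang_density (k + r) 1 x * indicator {b<..} x))"
    by (intro Bochner_Integration.integral_cong refl)
       (simp only: mult.assoc[symmetric] erlang_density_mult_power)
  also have "\<dots> = fact (k + r) / fact k * (LBINT x. erlang_density (k + r) 1 x * indicator {b<..} x)"
    by simp
  also have "(LBINT x. erlang_density (k + r) 1 x * indicator {b<..} x) =
      (LINT x|?D. indicator {b<..} x)"
    by (rule distributed_integral[OF idD]) auto
  also have "\<dots> = \<P>(x in ?D. b < x)"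
    by (simp add: greaterThan_def)
  also have "\<dots> = gamma_tail (Suc (k + r)) b"
    by (rule D.erlang_tail[OF idD b])
  finally show ?thesis .
qed

text \<open>Almost surely \<open>Y\<close> is nonnegative, where powers are monotone; the excess is
  therefore \<open>Y ^ r - b ^ r\<close> on \<open>b < Y\<close> and zero elsewhere.\<close>

lemma (in prob_space) erlang_expected_excess:
  assumes D: "distributed M lborel Y (erlang_density k 1)" and b: "0 \<le> b" and r: "1 \<le> r"
  shows "expectation (\<lambda>\<omega>. max 0 (Y \<omega> ^ r - b ^ r)) =
           fact (k + r) / fact k * gamma_tail (Suc (k + r)) b - b ^ r * gamma_tail (Suc k) b"
proof -
  have [measurable]: "Y \<in> borel_measurable M"
    using distributed_measurable[OF D] by simp
  have int: "integrable M (\<lambda>\<omega>. Y \<omega> ^ i * indicator {b<..} (Y \<omega>))" for i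
    by (rule Bochner_Integration.integrable_bound[OF erlang_ith_moment_integrable[OF _ D, of i]])
       (auto split: split_indicator)
  \<comment> \<open>The factor \<open>Y \<omega> ^ 0\<close> makes both terms truncated moments,
    with exponents \<open>r\<close> and \<open>0\<close>.\<close>
  have "expectation (\<lambda>\<omega>. max 0 (Y \<omega> ^ r - b ^ r)) =
      expectation (\<lambda>\<omega>. Y \<omega> ^ r * indicator {b<..} (Y \<omega>) - b ^ r * (Y \<omega> ^ 0 * indicator {b<..} (Y \<omega>)))"
  proof (intro integral_cong_AE)
    show "AE \<omega> in M. max 0 (Y \<omega> ^ r - b ^ r) =
        Y \<omega> ^ r * indicator {b<..} (Y \<omega>) - b ^ r * (Y \<omega> ^ 0 * indicator {b<..} (Y \<omega>))"
      using erlang_AE_nonneg[OF D]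
    proof eventually_elim
      case (elim \<omega>)
      show ?case
      proof (cases "b < Y \<omega>")
        case True
        then show ?thesis using power_mono[of b "Y \<omega>" r] b by simp
      next
        case False
        then show ?thesis using power_mono[of "Y \<omega>" b r] elim by simp
      qed
    qed
  qed simp_all
  also have "\<dots> = expectation (\<lambda>\<omega>. Y \<omega> ^ r * indicator {b<..} (Y \<omega>)) -
      b ^ r * expectation (\<lambda>\<omega>. Y \<omega> ^ 0 * indicator {b<..} (Y \<omega>))"
    using int[of r] int[of 0] by simp
  also have "\<dots> = fact (k + r) / fact k * gamma_tail (Suc (k + r)) b - b ^ r * gamma_tail (Suc k) b"
    using erlang_truncated_moment[OF D b, of r] erlang_truncated_moment[OF D b, of 0] by simp
  finally show ?thesis .
qed

section \<open>Integrated tails and the Ross-Pekoz bound\<close>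

text \<open>Tonelli for the indicator of \<open>s \<le> t < Z \<omega>\<close>: for fixed
  \<open>\<omega>\<close> these \<open>t\<close> fill an interval of length
  \<open>max 0 (Z \<omega> - s)\<close>. The form \<open>has_bochner_integral\<close> gives
  integrability of the tail together with its value.\<close>

lemma (in prob_space) has_bochner_integral_tail:
  fixes Z :: "'a \<Rightarrow> real"
  assumes Z: "integrable M Z"
  shows "has_bochner_integral lborel (\<lambda>t. indicator {s..} t * \<P>(\<omega> in M. t < Z \<omega>))
           (expectation (\<lambda>\<omega>. max 0 (Z \<omega> - s)))"
proof (rule has_bochner_integral_nn_integral)
  have [measurable]: "Z \<in> borel_measurable M"
    using Z by simp
  interpret pair_sigma_finite M lborel ..
  have eq: "ennreal (indicator {s..} t * \<P>(\<omega> in M. t < Z \<omega>)) =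
      (\<integral>\<^sup>+\<omega>. indicator {s..} t * indicator {t<..} (Z \<omega>) \<partial>M)" for t
  proof -
    have "(\<integral>\<^sup>+\<omega>. indicator {t<..} (Z \<omega>) \<partial>M) = (\<integral>\<^sup>+\<omega>. indicator {\<omega>\<in>space M. t < Z \<omega>} \<omega> \<partial>M)"
      by (intro nn_integral_cong) (auto split: split_indicator)
    then have "(\<integral>\<^sup>+\<omega>. indicator {t<..} (Z \<omega>) \<partial>M) = ennreal \<P>(\<omega> in M. t < Z \<omega>)"
      by (simp add: emeasure_eq_measure)
    then show ?thesis
      by (auto split: split_indicator simp: nn_integral_cmult)
  qed
  show "(\<lambda>t. indicator {s..} t * \<P>(\<omega> in M. t < Z \<omega>)) \<in> borel_measurable lborel"
    by measurable
  have "(\<integral>\<^sup>+t. ennreal (indicator {s..} t * \<P>(\<omega> in M. t < Z \<omega>)) \<partial>lborel) =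
      (\<integral>\<^sup>+t. \<integral>\<^sup>+\<omega>. indicator {s..} t * indicator {t<..} (Z \<omega>) \<partial>M \<partial>lborel)"
    by (simp only: eq)
  also have "\<dots> = (\<integral>\<^sup>+\<omega>. \<integral>\<^sup>+t. indicator {s..} t * indicator {t<..} (Z \<omega>) \<partial>lborel \<partial>M)"
    by (rule Fubini') (measurable, simp add: indicator_def, measurable)
  also have "\<dots> = (\<integral>\<^sup>+\<omega>. ennreal (max 0 (Z \<omega> - s)) \<partial>M)"
  proof (intro nn_integral_cong)
    fix \<omega>
    have "(\<integral>\<^sup>+t. indicator {s..} t * indicator {t<..} (Z \<omega>) \<partial>lborel) =
        (\<integral>\<^sup>+t. indicator {s..<Z \<omega>} t \<partial>lborel)"
      by (intro nn_integral_cong) (auto split: split_indicator)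
    then show "(\<integral>\<^sup>+t. indicator {s..} t * indicator {t<..} (Z \<omega>) \<partial>lborel) = ennreal (max 0 (Z \<omega> - s))"
      by (auto simp: max_def ennreal_neg)
  qed
  also have "\<dots> = ennreal (expectation (\<lambda>\<omega>. max 0 (Z \<omega> - s)))"
    using Z by (intro nn_integral_eq_integral) auto
  finally show "(\<integral>\<^sup>+t. ennreal (indicator {s..} t * \<P>(\<omega> in M. t < Z \<omega>)) \<partial>lborel) =
    ennreal (expectation (\<lambda>\<omega>. max 0 (Z \<omega> - s)))" .
qed (auto)

lemma (in prob_space) set_integrable_tail:
  fixes Z :: "'a \<Rightarrow> real"
  assumes "integrable M Z"
  shows "set_integrable lborel {s..} (\<lambda>t. \<P>(\<omega> in M. t < Z \<omega>))"
  using has_bochner_integral_tail[OF assms, of s]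
  by (simp add: set_integrable_def has_bochner_integral_iff)

lemma (in prob_space) max_bound_eq:
  fixes Z :: "'a \<Rightarrow> real"
  assumes "integrable M Z"
  shows "max_bound M Z n s = s + real n * expectation (\<lambda>\<omega>. max 0 (Z \<omega> - s))"
  using has_bochner_integral_tail[OF assms, of s]
  by (simp add: max_bound_def set_lebesgue_integral_def has_bochner_integral_iff)

text \<open>The bound is convex in its level, with subgradient \<open>1 - n P(Z > s)\<close> at
  \<open>s\<close>; the condition makes this subgradient zero, so \<open>s\<close> is a global
  minimiser.\<close>

lemma (in prob_space) max_bound_minimal:
  fixes Z :: "'a \<Rightarrow> real"
  assumes Z: "integrable M Z" and s: "real n * \<P>(\<omega> in M. s < Z \<omega>) = 1"
  shows "max_bound M Z n s \<le> max_bound M Z n s'"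
proof -
  have [measurable]: "Z \<in> borel_measurable M"
    using Z by simp
  have int: "integrable M (\<lambda>\<omega>. max 0 (Z \<omega> - t))" for t
    using Z by auto
  have "\<P>(\<omega> in M. s < Z \<omega>) * (s - s') = expectation (\<lambda>\<omega>. indicator {\<omega>\<in>space M. s < Z \<omega>} \<omega> * (s - s'))"
    by simp
  \<comment> \<open>Where \<open>s < Z \<omega>\<close>, the first excess is at least
    \<open>Z \<omega> - s'\<close> and the second equals \<open>Z \<omega> - s\<close>; elsewhere
    the second vanishes.\<close>
  also have "\<dots> \<le> expectation (\<lambda>\<omega>. max 0 (Z \<omega> - s') - max 0 (Z \<omega> - s))"
    using int by (intro integral_mono) (auto split: split_indicator simp: emeasure_eq_measure)
  also have "\<dots> = expectation (\<lambda>\<omega>. max 0 (Z \<omega> - s')) - expectation (\<lambda>\<omega>. max 0 (Z \<omega> - s))"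
    using int by simp
  finally have "real n * (\<P>(\<omega> in M. s < Z \<omega>) * (s - s')) \<le>
      real n * (expectation (\<lambda>\<omega>. max 0 (Z \<omega> - s')) - expectation (\<lambda>\<omega>. max 0 (Z \<omega> - s)))"
    by (intro mult_left_mono) auto
  then show ?thesis
    using s by (simp add: max_bound_eq[OF Z] mult.assoc[symmetric] right_diff_distrib)
qed

section \<open>Maxima of finite samples\<close>

text \<open>Passing to an attaining index turns a power of the maximum into the power of one
  coordinate, without appeal to monotonicity of the power.\<close>

lemma sample_max_eq_component:
  assumes "1 \<le> n"
  obtains j where "j < n" "sample_max n X \<omega> = X j \<omega>"
proof -
  have "Max ((\<lambda>j. X j \<omega>) ` {..<n}) \<in> (\<lambda>j. X j \<omega>) ` {..<n}"
    using assms by (intro Max_in) (auto simp: lessThan_empty_iff)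
  then show ?thesis
    using that by (auto simp: sample_max_def)
qed

lemma sample_max_le_iff:
  assumes "1 \<le> n"
  shows "sample_max n X \<omega> \<le> a \<longleftrightarrow> (\<forall>j<n. X j \<omega> \<le> a)"
  unfolding sample_max_def using assms
  by (subst Max_le_iff) (auto simp: lessThan_empty_iff)

lemma borel_measurable_sample_max:
  assumes "\<And>j. j < n \<Longrightarrow> X j \<in> borel_measurable N"
  shows "sample_max n X \<in> borel_measurable N"
  unfolding sample_max_def[abs_def] using assms
  by (intro borel_measurable_Max) auto

lemma integrable_sample_max_power:
  assumes n: "1 \<le> n" and X: "\<And>j. j < n \<Longrightarrow> X j \<in> borel_measurable N"
    and int: "\<And>j. j < n \<Longrightarrow> integrable N (\<lambda>\<omega>. X j \<omega> ^ r)"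
  shows "integrable N (\<lambda>\<omega>. sample_max n X \<omega> ^ r)"
proof (rule Bochner_Integration.integrable_bound)
  show "integrable N (\<lambda>\<omega>. \<Sum>j<n. \<bar>X j \<omega> ^ r\<bar>)"
    using int by auto
  show "(\<lambda>\<omega>. sample_max n X \<omega> ^ r) \<in> borel_measurable N"
    using borel_measurable_sample_max[OF X] by simp
  have "\<bar>sample_max n X \<omega> ^ r\<bar> \<le> (\<Sum>j<n. \<bar>X j \<omega> ^ r\<bar>)" for \<omega>
  proof -
    obtain j where "j < n" "sample_max n X \<omega> = X j \<omega>"
      using n by (rule sample_max_eq_component)
    then show ?thesis
      using member_le_sum[of j "{..<n}" "\<lambda>j. \<bar>X j \<omega> ^ r\<bar>"] by simp
  qed
  then show "AE \<omega> in N. norm (sample_max n X \<omega> ^ r) \<le> norm (\<Sum>j<n. \<bar>X j \<omega> ^ r\<bar>)"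
    by (auto intro: order_trans)
qed

lemma (in prob_space) expectation_sample_max_power_le:
  assumes n: "1 \<le> n" and X: "\<And>j. j < n \<Longrightarrow> X j \<in> borel_measurable M"
    and int: "\<And>j. j < n \<Longrightarrow> integrable M (\<lambda>\<omega>. X j \<omega> ^ r)"
  shows "expectation (\<lambda>\<omega>. sample_max n X \<omega> ^ r) \<le>
           s + (\<Sum>j<n. expectation (\<lambda>\<omega>. max 0 (X j \<omega> ^ r - s)))"
proof -
  have int': "integrable M (\<lambda>\<omega>. max 0 (X j \<omega> ^ r - s))" if "j < n" for j
    using int[OF that] by auto
  have "expectation (\<lambda>\<omega>. sample_max n X \<omega> ^ r) \<le>
      expectation (\<lambda>\<omega>. s + (\<Sum>j<n. max 0 (X j \<omega> ^ r - s)))"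
  proof (rule integral_mono)
    show "integrable M (\<lambda>\<omega>. sample_max n X \<omega> ^ r)"
      using assms by (rule integrable_sample_max_power)
    show "integrable M (\<lambda>\<omega>. s + (\<Sum>j<n. max 0 (X j \<omega> ^ r - s)))"
      using int' by (intro Bochner_Integration.integrable_add Bochner_Integration.integrable_sum) auto
    fix \<omega>
    obtain j where "j < n" "sample_max n X \<omega> = X j \<omega>"
      using n by (rule sample_max_eq_component)
    \<comment> \<open>The summand at the attaining index already suffices, and the other summands
      are nonnegative.\<close>
    then show "sample_max n X \<omega> ^ r \<le> s + (\<Sum>j<n. max 0 (X j \<omega> ^ r - s))"
      using member_le_sum[of j "{..<n}" "\<lambda>j. max 0 (X j \<omega> ^ r - s)"] by simp
  qed
  also have "\<dots> = s + (\<Sum>j<n. expectation (\<lambda>\<omega>. max 0 (X j \<omega> ^ r - s)))"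
    using int' by (subst Bochner_Integration.integral_add, (auto simp: prob_space)[2])
      (subst Bochner_Integration.integral_sum, auto simp: prob_space)
  finally show ?thesis .
qed

lemma (in prob_space) prob_sample_max_le:
  assumes n: "1 \<le> n" and indep: "indep_vars (\<lambda>_. borel) X {..<n}"
    and p: "\<And>j. j < n \<Longrightarrow> \<P>(\<omega> in M. a < X j \<omega>) = p"
  shows "\<P>(\<omega> in M. sample_max n X \<omega> \<le> a) = (1 - p) ^ n"
proof -
  have X: "X j \<in> borel_measurable M" if "j < n" for j
    using indep that by (auto simp: indep_vars_def)
  have le: "\<P>(\<omega> in M. X j \<omega> \<le> a) = 1 - p" if "j < n" for j
  proof -
    have [measurable]: "X j \<in> borel_measurable M"
      using X[OF that] .
    have "prob (space M - {\<omega>\<in>space M. a < X j \<omega>}) = 1 - p"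
      using p[OF that] by (subst prob_compl) auto
    moreover have "space M - {\<omega>\<in>space M. a < X j \<omega>} = {\<omega>\<in>space M. X j \<omega> \<le> a}"
      by auto
    ultimately show ?thesis by simp
  qed
  have "{\<omega>\<in>space M. sample_max n X \<omega> \<le> a} = (\<Inter>j\<in>{..<n}. X j -` {..a} \<inter> space M)"
    using n by (auto simp: sample_max_le_iff lessThan_empty_iff)
  then have "\<P>(\<omega> in M. sample_max n X \<omega> \<le> a) = (\<Prod>j<n. prob (X j -` {..a} \<inter> space M))"
    using indep_varsD[OF indep, of "{..<n}" "\<lambda>_. {..a}"] n by (simp add: lessThan_empty_iff)
  also have "\<dots> = (\<Prod>j<n. 1 - p)"
    using le by (intro prod.cong) (auto simp: vimage_def Int_def conj_commute)
  finally show ?thesis by simp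
qed

text \<open>A Markov-type bound: the power of the maximum is at least \<open>a ^ r\<close> on the
  event that the maximum exceeds \<open>a\<close>, and almost surely nonnegative off it.
  Independence makes the complement have probability \<open>(1 - p) ^ n\<close>.\<close>

lemma (in prob_space) expectation_sample_max_power_ge:
  assumes n: "1 \<le> n" and indep: "indep_vars (\<lambda>_. borel) X {..<n}"
    and p: "\<And>j. j < n \<Longrightarrow> \<P>(\<omega> in M. a < X j \<omega>) = p"
    and nonneg: "\<And>j. j < n \<Longrightarrow> AE \<omega> in M. 0 \<le> X j \<omega>"
    and int: "\<And>j. j < n \<Longrightarrow> integrable M (\<lambda>\<omega>. X j \<omega> ^ r)"
    and a: "0 \<le> a"
  shows "a ^ r * (1 - exp (- (real n * p))) \<le> expectation (\<lambda>\<omega>. sample_max n X \<omega> ^ r)"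
proof -
  have X: "X j \<in> borel_measurable M" if "j < n" for j
    using indep that by (auto simp: indep_vars_def)
  have [measurable]: "sample_max n X \<in> borel_measurable M"
    using X by (rule borel_measurable_sample_max)
  have "p \<le> 1"
    using p[of 0] n by (auto simp flip: p)
  \<comment> \<open>\<open>1 - p \<le> exp (- p)\<close>, raised to the power \<open>n\<close>;
    \<open>p \<le> 1\<close> keeps the base nonnegative.\<close>
  have "(1 - p) ^ n \<le> exp (- p) ^ n"
    using \<open>p \<le> 1\<close> exp_ge_add_one_self[of "- p"] by (intro power_mono) auto
  also have "\<dots> = exp (- (real n * p))"
    by (simp flip: exp_of_nat_mult)
  finally have "a ^ r * (1 - exp (- (real n * p))) \<le> a ^ r * (1 - (1 - p) ^ n)"
    using a by (intro mult_left_mono) auto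
  also have "1 - (1 - p) ^ n = prob (space M - {\<omega>\<in>space M. sample_max n X \<omega> \<le> a})"
    by (subst prob_compl) (auto simp: prob_sample_max_le[OF n indep p])
  also have "space M - {\<omega>\<in>space M. sample_max n X \<omega> \<le> a} = {\<omega>\<in>space M. a < sample_max n X \<omega>}"
    by auto
  also have "a ^ r * prob {\<omega>\<in>space M. a < sample_max n X \<omega>} =
      expectation (\<lambda>\<omega>. a ^ r * indicator {\<omega>\<in>space M. a < sample_max n X \<omega>} \<omega>)"
    by simp
  also have "\<dots> \<le> expectation (\<lambda>\<omega>. sample_max n X \<omega> ^ r)"
  proof (rule integral_mono_AE)
    show "integrable M (\<lambda>\<omega>. a ^ r * indicator {\<omega>\<in>space M. a < sample_max n X \<omega>} \<omega>)"
      by (auto simp: emeasure_eq_measure)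
    show "integrable M (\<lambda>\<omega>. sample_max n X \<omega> ^ r)"
      using n X int by (rule integrable_sample_max_power)
    have "AE \<omega> in M. \<forall>j\<in>{..<n}. 0 \<le> X j \<omega>"
      using nonneg by (subst AE_finite_all) auto
    then show "AE \<omega> in M. a ^ r * indicator {\<omega>\<in>space M. a < sample_max n X \<omega>} \<omega> \<le> sample_max n X \<omega> ^ r"
    proof eventually_elim
      case (elim \<omega>)
      obtain j where "j < n" "sample_max n X \<omega> = X j \<omega>"
        using n by (rule sample_max_eq_component)
      with elim have "0 \<le> sample_max n X \<omega>"
        by auto
      then show ?case
        using a by (auto split: split_indicator intro: power_mono)
    qed
  qed
  finally show ?thesis .
qed

section \<open>Asymptotics of Gamma tails along the centering sequence\<close>

text \<open>Only the summand \<open>j = 0\<close> is kept; this crude bound is enough for the lower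
  estimate of the expected maximum.\<close>

lemma gamma_tail_ge_exp:
  assumes "1 \<le> k" "0 \<le> a"
  shows "exp (- a) \<le> gamma_tail k a"
proof -
  have "1 \<le> (\<Sum>j<k. a ^ j / fact j)"
    using assms member_le_sum[of 0 "{..<k}" "\<lambda>j. a ^ j / fact j"] by auto
  then show ?thesis
    unfolding gamma_tail_def by simp
qed

text \<open>The sum is a polynomial of degree \<open>m\<close>, so after division only its leading
  coefficient survives.\<close>

lemma exp_partial_sum_asymp:
  "((\<lambda>a::real. (\<Sum>j<Suc m. a ^ j / fact j) / a ^ m) \<longlongrightarrow> 1 / fact m) at_top"
proof -
  have lower: "((\<lambda>a::real. a ^ j / fact j / a ^ m) \<longlongrightarrow> 0) at_top" if "j < m" for j
  proof -
    have "((\<lambda>a::real. inverse (a ^ (m - j)) / fact j) \<longlongrightarrow> 0 / fact j) at_top"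
      using that by (intro tendsto_intros tendsto_inverse_0_at_top filterlim_pow_at_top filterlim_ident) auto
    moreover have "\<forall>\<^sub>F a::real in at_top. inverse (a ^ (m - j)) / fact j = a ^ j / fact j / a ^ m"
      using eventually_gt_at_top[of 0]
      by eventually_elim (use that in \<open>simp add: power_diff field_simps\<close>)
    ultimately show ?thesis
      by (rule tendsto_eq_rhs[OF Lim_transform_eventually]) simp
  qed
  have "((\<lambda>a::real. (\<Sum>j<m. a ^ j / fact j / a ^ m) + 1 / fact m) \<longlongrightarrow> (\<Sum>j<m. 0) + 1 / fact m) at_top"
    by (intro tendsto_intros lower) auto
  moreover have "\<forall>\<^sub>F a::real in at_top. (\<Sum>j<m. a ^ j / fact j / a ^ m) + 1 / fact m =
      (\<Sum>j<Suc m. a ^ j / fact j) / a ^ m"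
    using eventually_gt_at_top[of 0]
    by eventually_elim (simp add: sum_divide_distrib add_divide_distrib)
  ultimately show ?thesis
    by (rule tendsto_eq_rhs[OF Lim_transform_eventually]) simp
qed

text \<open>The constant and the iterated logarithm are negligible against \<open>ln n\<close>, so
  the centering may be exchanged for \<open>ln n\<close> in polynomial factors.\<close>

lemma gamma_centering_asymp_ln:
  "(\<lambda>n. gamma_centering c n / ln (real n)) \<longlonglongrightarrow> 1"
proof -
  let ?K = "ln (Gamma (real c))"
  have "(\<lambda>n::nat. 1 / ln (real n)) \<longlonglongrightarrow> 0" "(\<lambda>n::nat. ln (ln (real n)) / ln (real n)) \<longlonglongrightarrow> 0"
    by real_asymp+
  then have "(\<lambda>n::nat. 1 - ?K * (1 / ln (real n)) + (real c - 1) * (ln (ln (real n)) / ln (real n)))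
      \<longlonglongrightarrow> 1 - ?K * 0 + (real c - 1) * 0"
    by (intro tendsto_intros)
  moreover have "\<forall>\<^sub>F n in sequentially.
      1 - ?K * (1 / ln (real n)) + (real c - 1) * (ln (ln (real n)) / ln (real n)) =
      gamma_centering c n / ln (real n)"
    using eventually_gt_at_top[of 1]
    by eventually_elim (simp add: gamma_centering_def field_simps)
  ultimately show ?thesis
    by (rule tendsto_eq_rhs[OF Lim_transform_eventually]) simp
qed

lemma gamma_centering_at_top: "filterlim (gamma_centering c) at_top sequentially"
proof -
  have "filterlim (\<lambda>n::nat. ln (real n)) at_top sequentially"
    by real_asymp
  then have "filterlim (\<lambda>n. gamma_centering c n / ln (real n) * ln (real n)) at_top sequentially"
    by (rule filterlim_tendsto_pos_mult_at_top[OF gamma_centering_asymp_ln zero_less_one])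
  moreover have "\<forall>\<^sub>F n in sequentially. gamma_centering c n / ln (real n) * ln (real n) = gamma_centering c n"
    using eventually_gt_at_top[of 1] by eventually_elim simp
  ultimately show ?thesis
    using filterlim_cong[OF refl refl] by force
qed

text \<open>This identity explains the shape of the centering: \<open>ln n\<close> cancels the
  sample size, the Gamma term gives \<open>(c - 1)!\<close>, and the iterated logarithm gives the
  power of \<open>ln n\<close> that the polynomial factor of the tail will cancel.\<close>

lemma exp_minus_gamma_centering:
  assumes c: "1 \<le> c" and n: "1 < n"
  shows "real n * exp (- gamma_centering c n) = fact (c - 1) / ln (real n) ^ (c - 1)"
proof -
  have L: "0 < ln (real n)"
    using n by simp
  have "real c = 1 + real (c - 1)"
    using c by simp
  then have G: "Gamma (real c) = fact (c - 1)"
    by (metis Gamma_fact)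
  have "exp ((real c - 1) * ln (ln (real n))) = exp (real (c - 1) * ln (ln (real n)))"
    using c by (simp add: of_nat_diff)
  also have "\<dots> = ln (real n) ^ (c - 1)"
    using L by (simp add: exp_of_nat_mult)
  finally have "exp ((real c - 1) * ln (ln (real n))) = ln (real n) ^ (c - 1)" .
  then show ?thesis
    using n L by (simp add: gamma_centering_def G exp_minus exp_add exp_diff field_simps)
qed

text \<open>The case \<open>i = 0\<close> yields the optimality condition; \<open>i = 0\<close> and
  \<open>i = r\<close> together handle the expected excess.\<close>

lemma gamma_tail_centering_asymp:
  assumes c: "1 \<le> c"
  shows "(\<lambda>n. real n * gamma_tail (c + i) (gamma_centering c n) / gamma_centering c n ^ i)
           \<longlonglongrightarrow> fact (c - 1) / fact (c - 1 + i)"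
proof -
  let ?b = "gamma_centering c" and ?m = "c - 1 + i"
  let ?S = "\<lambda>a::real. (\<Sum>j<Suc ?m. a ^ j / fact j) / a ^ ?m"
  have Suc: "c + i = Suc ?m"
    using c by simp
  \<comment> \<open>The power \<open>?b n ^ ?m\<close> is split as
    \<open>?b n ^ (c - 1) * ?b n ^ i\<close>: the first part is compared with the power of
    \<open>ln n\<close>, the second is the normalisation in the claim.\<close>
  have "(\<lambda>n. fact (c - 1) * (?b n / ln (real n)) ^ (c - 1) * ?S (?b n))
      \<longlonglongrightarrow> fact (c - 1) * 1 ^ (c - 1) * (1 / fact ?m)"
    by (intro tendsto_intros gamma_centering_asymp_ln
        filterlim_compose[OF exp_partial_sum_asymp gamma_centering_at_top])
  moreover have "\<forall>\<^sub>F n in sequentially. fact (c - 1) * (?b n / ln (real n)) ^ (c - 1) * ?S (?b n) =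
      real n * gamma_tail (c + i) (?b n) / ?b n ^ i"
    using eventually_gt_at_top[of 1]
      filterlim_at_top_dense[THEN iffD1, rule_format, OF gamma_centering_at_top, of 0 c]
  proof eventually_elim
    case (elim n)
    let ?Q = "\<Sum>j<Suc ?m. ?b n ^ j / fact j"
    have "fact (c - 1) * (?b n / ln (real n)) ^ (c - 1) * ?S (?b n) =
        fact (c - 1) / ln (real n) ^ (c - 1) * ?Q / ?b n ^ i"
      using elim by (simp add: power_divide power_add del: sum.lessThan_Suc)
    also have "\<dots> = real n * exp (- ?b n) * ?Q / ?b n ^ i"
      using exp_minus_gamma_centering[OF c elim(1)] by simp
    finally show ?case
      by (simp only: gamma_tail_def Suc mult.assoc)
  qed
  ultimately show ?thesis
    by (rule tendsto_eq_rhs[OF Lim_transform_eventually]) simp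
qed

lemma (in prob_space) max_bound_gamma_power_asymp:
  assumes c: "1 \<le> c" and r: "1 \<le> r"
    and D: "distributed M lborel Y (erlang_density (c - 1) 1)"
  shows "(\<lambda>n. max_bound M (\<lambda>\<omega>. Y \<omega> ^ r) n (gamma_centering c n ^ r) / gamma_centering c n ^ r)
           \<longlonglongrightarrow> 1"
proof -
  let ?b = "gamma_centering c"
  let ?C = "fact (c - 1 + r) / fact (c - 1) :: real"
  let ?A = "\<lambda>i n. real n * gamma_tail (c + i) (?b n) / ?b n ^ i"
  have Suc: "Suc (c - 1) = c" "Suc (c - 1 + r) = c + r"
    using c by auto
  \<comment> \<open>After division by \<open>?b n ^ r\<close>, the two parts of the excess both tend
    to 1 and cancel, leaving the contribution of the level itself.\<close>
  have "(\<lambda>n. 1 + ?C * ?A r n - ?A 0 n)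
      \<longlonglongrightarrow> 1 + ?C * (fact (c - 1) / fact (c - 1 + r)) - fact (c - 1) / fact (c - 1 + 0)"
    by (intro tendsto_intros gamma_tail_centering_asymp c)
  also have "1 + ?C * (fact (c - 1) / fact (c - 1 + r)) - fact (c - 1) / fact (c - 1 + 0) = 1"
    by simp
  finally have "(\<lambda>n. 1 + ?C * ?A r n - ?A 0 n) \<longlonglongrightarrow> 1" .
  moreover have "\<forall>\<^sub>F n in sequentially. 1 + ?C * ?A r n - ?A 0 n =
      max_bound M (\<lambda>\<omega>. Y \<omega> ^ r) n (?b n ^ r) / ?b n ^ r"
    using filterlim_at_top_dense[THEN iffD1, rule_format, OF gamma_centering_at_top, of 0 c]
  proof eventually_elim
    case (elim n)
    have "max_bound M (\<lambda>\<omega>. Y \<omega> ^ r) n (?b n ^ r) =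
        ?b n ^ r + real n * (?C * gamma_tail (c + r) (?b n) - ?b n ^ r * gamma_tail c (?b n))"
      using erlang_expected_excess[OF D _ r, of "?b n", unfolded Suc] erlang_ith_moment_integrable[OF _ D, of r] elim
      by (simp add: max_bound_eq)
    then show ?case
      using elim by (simp add: add_divide_distrib diff_divide_distrib right_diff_distrib)
  qed
  ultimately show ?thesis
    by (rule Lim_transform_eventually)
qed

section \<open>Tightness and optimality of the centering\<close>

theorem proposition25:
  fixes M :: "'a measure" and Y :: "'a \<Rightarrow> real"
    and N :: "nat \<Rightarrow> 'b measure" and X :: "nat \<Rightarrow> nat \<Rightarrow> 'b \<Rightarrow> real"
    and c r :: nat
  assumes c: "1 \<le> c" and r: "1 \<le> r"
    and M: "prob_space M"
    and Y: "Y \<in> borel_measurable M" "distr M borel Y = gamma_law c"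
    and N: "\<And>n. 1 \<le> n \<Longrightarrow> prob_space (N n)"
    and X_indep: "\<And>n. 1 \<le> n \<Longrightarrow> prob_space.indep_vars (N n) (\<lambda>_. borel) (X n) {..<n}"
    and X_law: "\<And>n j. j < n \<Longrightarrow> distr (N n) borel (X n j) = gamma_law c"
  shows
    "(\<forall>n\<ge>1. integrable (N n) (\<lambda>\<omega>. sample_max n (X n) \<omega> ^ r)) \<and>
     (\<forall>s\<ge>0. set_integrable lborel {s..} (\<lambda>t. \<P>(\<omega> in M. t < Y \<omega> ^ r))) \<and>
     (\<forall>n\<ge>1. \<forall>s\<ge>0.
        (LINT \<omega>|N n. sample_max n (X n) \<omega> ^ r) \<le> max_bound M (\<lambda>\<omega>. Y \<omega> ^ r) n s) \<and>
     (\<exists>s. (\<forall>n. 0 \<le> s n) \<and>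
        (\<lambda>n. max_bound M (\<lambda>\<omega>. Y \<omega> ^ r) n (s n) / (LINT \<omega>|N n. sample_max n (X n) \<omega> ^ r))
          \<longlonglongrightarrow> 1) \<and>
     (\<forall>\<^sub>F n in sequentially. 0 \<le> gamma_centering c n) \<and>
     (\<lambda>n. max_bound M (\<lambda>\<omega>. Y \<omega> ^ r) n (gamma_centering c n ^ r) /
            (LINT \<omega>|N n. sample_max n (X n) \<omega> ^ r))
       \<longlonglongrightarrow> 1 \<and>
     (\<forall>n\<ge>1. \<forall>s\<ge>0. real n * \<P>(\<omega> in M. s < Y \<omega> ^ r) = 1 \<longrightarrow>
        (\<forall>s'\<ge>0. max_bound M (\<lambda>\<omega>. Y \<omega> ^ r) n s \<le> max_bound M (\<lambda>\<omega>. Y \<omega> ^ r) n s')) \<and>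
     (\<lambda>n. real n * \<P>(\<omega> in M. gamma_centering c n ^ r < Y \<omega> ^ r)) \<longlonglongrightarrow> 1"
proof -
  let ?b = "gamma_centering c"
  let ?Z = "\<lambda>\<omega>. Y \<omega> ^ r"
  let ?U = "max_bound M ?Z"
  let ?E = "\<lambda>n. LINT \<omega>|N n. sample_max n (X n) \<omega> ^ r"
  interpret M: prob_space M by (rule M)
  have Suc: "Suc (c - 1) = c"
    using c by simp
  have D: "distributed M lborel Y (erlang_density (c - 1) 1)"
    using c Y by (rule distributed_gamma_law)
  have Z: "integrable M ?Z"
    by (rule M.erlang_ith_moment_integrable[OF _ D]) simp
  have X: "X n j \<in> borel_measurable (N n)" if "j < n" for n j
    using X_indep[of n] N[of n] that by (auto simp: prob_space.indep_vars_def)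
  have DX: "distributed (N n) lborel (X n j) (erlang_density (c - 1) 1)" if "j < n" for n j
    using c X[OF that] X_law[OF that] by (rule distributed_gamma_law)
  have int_X: "integrable (N n) (\<lambda>\<omega>. X n j \<omega> ^ r)" if "j < n" for n j
    using prob_space.erlang_ith_moment_integrable[OF N _ DX[OF that], of r] that by simp

  have int_max: "integrable (N n) (\<lambda>\<omega>. sample_max n (X n) \<omega> ^ r)" if "1 \<le> n" for n
    using that X int_X by (rule integrable_sample_max_power)

  have upper: "?E n \<le> ?U n s" if n: "1 \<le> n" for n s
  proof -
    \<comment> \<open>\<open>Y\<close> and the sample live on different probability spaces, so the
      two expectations are compared through their common law.\<close>
    have same: "(LINT \<omega>|N n. max 0 (X n j \<omega> ^ r - s)) = M.expectation (\<lambda>\<omega>. max 0 (?Z \<omega> - s))"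
      if "j < n" for j
    proof -
      have "(LINT \<omega>|N n. max 0 (X n j \<omega> ^ r - s)) = (LINT x|gamma_law c. max 0 (x ^ r - s))"
        using X[OF that] by (subst X_law[OF that, symmetric], subst integral_distr) auto
      also have "\<dots> = M.expectation (\<lambda>\<omega>. max 0 (?Z \<omega> - s))"
        using Y(1) by (subst Y(2)[symmetric], subst integral_distr) auto
      finally show ?thesis .
    qed
    have "?E n \<le> s + (\<Sum>j<n. LINT \<omega>|N n. max 0 (X n j \<omega> ^ r - s))"
      using N[OF n] n X int_X by (rule prob_space.expectation_sample_max_power_le)
    also have "\<dots> = ?U n s"
      by (simp add: same M.max_bound_eq[OF Z])
    finally show ?thesis .
  qed

  \<comment> \<open>Subtracting \<open>ln (ln n)\<close> makes \<open>n * exp (- a n)\<close> equal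
    to \<open>ln n\<close>, which diverges, while \<open>a n\<close> remains asymptotic to
    \<open>ln n\<close> and hence to the centering.\<close>
  define a where "a n = ln (real n) - ln (ln (real n))" for n :: nat
  have a_pos: "\<forall>\<^sub>F n in sequentially. 0 < a n"
    unfolding a_def by real_asymp
  have lower: "\<forall>\<^sub>F n in sequentially. a n ^ r * (1 - 1 / real n) \<le> ?E n"
    using a_pos eventually_gt_at_top[of 1]
  proof eventually_elim
    case (elim n)
    then have n: "1 \<le> n" and a: "0 \<le> a n" and L: "0 < ln (real n)"
      by auto
    interpret Nn: prob_space "N n"
      using n by (rule N)
    have "ln (real n) = real n * exp (- a n)"
      using elim L by (simp add: a_def exp_diff)
    also have "\<dots> \<le> real n * gamma_tail c (a n)"
      using gamma_tail_ge_exp[OF c a] by (intro mult_left_mono) auto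
    finally have "exp (- (real n * gamma_tail c (a n))) \<le> exp (- ln (real n))"
      by simp
    also have "\<dots> = 1 / real n"
      using n by (simp add: exp_minus field_simps)
    finally have "a n ^ r * (1 - 1 / real n) \<le> a n ^ r * (1 - exp (- (real n * gamma_tail c (a n))))"
      using a by (intro mult_left_mono) auto
    also have "\<dots> \<le> ?E n"
      using Nn.erlang_tail[OF DX a, unfolded Suc] Nn.erlang_AE_nonneg[OF DX]
      by (intro Nn.expectation_sample_max_power_ge n X_indep int_X a) auto
    finally show ?case .
  qed

  have b_pos: "\<forall>\<^sub>F n in sequentially. 0 < ?b n"
    using gamma_centering_at_top by (simp add: filterlim_at_top_dense)
  have ratio: "(\<lambda>n. ?U n (?b n ^ r) / ?E n) \<longlonglongrightarrow> 1"
  proof (rule tendsto_sandwich[OF _ _ tendsto_const])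
    \<comment> \<open>With \<open>lower\<close>, this makes the expected maximum eventually
      positive, so that dividing by it preserves inequalities.\<close>
    have pos: "\<forall>\<^sub>F n in sequentially. 0 < a n ^ r * (1 - 1 / real n)"
      using a_pos eventually_gt_at_top[of 1] by eventually_elim simp
    show "\<forall>\<^sub>F n in sequentially. 1 \<le> ?U n (?b n ^ r) / ?E n"
      using pos lower eventually_ge_at_top[of 1]
      by eventually_elim (use upper in simp)
    \<comment> \<open>The bound over \<open>a n ^ r * (1 - 1 / real n)\<close>, factored into terms
      tending to 1; the centering and \<open>a n\<close> are compared through
      \<open>ln n\<close>.\<close>
    let ?R = "\<lambda>n. ?U n (?b n ^ r) / ?b n ^ r * (?b n / ln (real n) * (ln (real n) / a n)) ^ r * (1 / (1 - 1 / real n))"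
    show "\<forall>\<^sub>F n in sequentially. ?U n (?b n ^ r) / ?E n \<le> ?R n"
      using pos lower a_pos b_pos eventually_gt_at_top[of 1]
    proof eventually_elim
      case (elim n)
      have E_pos: "0 < ?E n"
        using elim(1,2) by linarith
      have "?E n \<le> ?U n (?b n ^ r)"
        using elim(5) by (intro upper) simp
      with E_pos have U_nonneg: "0 \<le> ?U n (?b n ^ r)"
        by linarith
      have "?U n (?b n ^ r) / ?E n \<le> ?U n (?b n ^ r) / (a n ^ r * (1 - 1 / real n))"
        by (rule divide_left_mono[OF elim(2) U_nonneg mult_pos_pos[OF E_pos elim(1)]])
      also have "\<dots> = ?R n"
        using elim by (simp add: power_divide)
      finally show ?case .
    qed
    have "(\<lambda>n. ln (real n) / a n) \<longlonglongrightarrow> 1" "(\<lambda>n::nat. 1 / (1 - 1 / real n)) \<longlonglongrightarrow> 1"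
      unfolding a_def by real_asymp+
    then have "?R \<longlonglongrightarrow> 1 * (1 * 1) ^ r * 1"
      by (intro tendsto_mult tendsto_power gamma_centering_asymp_ln
          M.max_bound_gamma_power_asymp[OF c r D])
    then show "?R \<longlonglongrightarrow> 1"
      by simp
  qed

  have optimal: "(\<lambda>n. real n * \<P>(\<omega> in M. ?b n ^ r < ?Z \<omega>)) \<longlonglongrightarrow> 1"
  proof -
    have "(\<lambda>n. real n * gamma_tail c (?b n)) \<longlonglongrightarrow> 1"
      using gamma_tail_centering_asymp[OF c, of 0] by simp
    moreover have "\<forall>\<^sub>F n in sequentially. real n * gamma_tail c (?b n) =
        real n * \<P>(\<omega> in M. ?b n ^ r < ?Z \<omega>)"
      using b_pos
    proof eventually_elim
      case (elim n)
      have "\<P>(\<omega> in M. ?b n ^ r < ?Z \<omega>) = \<P>(\<omega> in M. ?b n < Y \<omega>)"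
      proof (rule M.prob_eq_AE)
        \<comment> \<open>The power is strictly increasing only on nonnegative reals, so the two
          events agree up to the null set where \<open>Y\<close> is negative.\<close>
        show "AE \<omega> in M. ?b n ^ r < ?Z \<omega> \<longleftrightarrow> ?b n < Y \<omega>"
          using M.erlang_AE_nonneg[OF D]
        proof eventually_elim
          case (elim \<omega>)
          then show ?case
            using \<open>0 < ?b n\<close> r power_strict_mono[of "?b n" "Y \<omega>" r] power_less_imp_less_base[of "?b n" r "Y \<omega>"]
            by auto
        qed
      qed (use Y(1) in measurable)
      then show ?case
        using M.erlang_tail[OF D, of "?b n", unfolded Suc] elim by simp
    qed
    ultimately show ?thesis
      by (rule Lim_transform_eventually)
  qed

  \<comment> \<open>The witness must be nonnegative for every \<open>n\<close>, whereas the
    centering is only eventually so; clipping at zero leaves the limit unchanged.\<close>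
  have "(\<lambda>n. ?U n (max 0 (?b n) ^ r) / ?E n) \<longlonglongrightarrow> 1"
  proof (rule Lim_transform_eventually[OF ratio])
    show "\<forall>\<^sub>F n in sequentially. ?U n (?b n ^ r) / ?E n = ?U n (max 0 (?b n) ^ r) / ?E n"
      using b_pos by eventually_elim simp
  qed
  then have tight: "\<exists>s. (\<forall>n. 0 \<le> s n) \<and> (\<lambda>n. ?U n (s n) / ?E n) \<longlonglongrightarrow> 1"
    by (intro exI[of _ "\<lambda>n. max 0 (?b n) ^ r"]) auto
  have nonneg: "\<forall>\<^sub>F n in sequentially. 0 \<le> ?b n"
    using b_pos by eventually_elim simp
  show ?thesis
    by (intro conjI allI impI int_max M.set_integrable_tail[OF Z] upper tight nonneg ratio
        M.max_bound_minimal[OF Z] optimal)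
qed

end
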